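(* Let $k\geqslant3$ and let $G$ be a $d$-regular graph. If $\alpha\neq0$ is an eigenvalue of (the adjacency matrix of) $G$, then every root $x\in\mathbb{C}$ of $(d-x)(1-x)^{\frac{k-2}{2}}-\alpha=0$ is an eigenvalue of the Laplacian tensor $\mathcal{L}_{G^k}$.
   Context: A graph is a finite simple undirected graph; it is $d$-regular if every vertex has exactly $d$ neighbours. For $k\geqslant3$, the $k$th power $G^k$ is the $k$-uniform hypergraph with vertex set $V(G)\cup\{i_{e,j}: e\in E(G),\ j\in[k-2]\}$ (new distinct vertices $i_{e,j}$) and edge set $\{e\cup\{i_{e,1},\ldots,i_{e,k-2}\}: e\in E(G)\}$. For a $k$-uniform hypergraph $H$ on $n$ vertices: the adjacency tensor $\mathcal{A}_H$ has entries $\frac{1}{(k-1)!}$ at $(i_1,\ldots,i_k)$ if $\{i_1,\ldots,i_k\}\in E(H)$ and $0$ otherwise; $\mathcal{D}_H$ is the diagonal tensor with the degree of $i$ at $(i,\ldots,i)$; $\mathcal{L}_H=\mathcal{D}_H-\mathcal{A}_H$. For an order $k$ dimension $n$ tensor $\mathcal{T}$, $(\mathcal{T}y)_i=\sum_{i_2,\ldots,i_k}t_{ii_2\cdots i_k}y_{i_2}\cdots y_{i_k}$; $\lambda\in\mathbb{C}$ is an eigenvalue if $\mathcal{T}y=\lambda y^{[k-1]}$ for some nonzero $y\in\mathbb{C}^n$, with $y^{[k-1]}=(y_1^{k-1},\ldots,y_n^{k-1})^\top$. When $k$ is odd, $(1-x)^{\frac{k-2}{2}}$ means $s^{k-2}$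 for a choice of square root $s$ of $1-x$ (a root is any $x$ for which some such choice satisfies the equation). *)

theory Defs
  imports Complex_Main
begin

record 'a hypergraph =
  verts :: "'a set"
  edges :: "'a set set"

definition uniform_hypergraph :: "nat \<Rightarrow> 'a hypergraph \<Rightarrow> bool" where
  "uniform_hypergraph k H \<longleftrightarrow>
     finite (verts H) \<and> (\<forall>e\<in>edges H. e \<subseteq> verts H \<and> card e = k)"

definition degree :: "'a hypergraph \<Rightarrow> 'a \<Rightarrow> nat" where
  "degree H i = card {e \<in> edges H. i \<in> e}"

text \<open>A finite simple undirected graph: edges are two-element sets of vertices.\<close>

abbreviation simple_graph :: "'a hypergraph \<Rightarrow> bool" where
  "simple_graph \<equiv> uniform_hypergraph 2"

definition neighbours :: "'a hypergraph \<Rightarrow> 'a \<Rightarrow> 'a set" where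
  "neighbours G i = {j \<in> verts G. {i, j} \<in> edges G}"

definition regular :: "nat \<Rightarrow> 'a hypergraph \<Rightarrow> bool" where
  "regular d G \<longleftrightarrow> (\<forall>i\<in>verts G. card (neighbours G i) = d)"

text \<open>Matrices, tensors and vectors are indexed by a finite vertex set \<open>V\<close>;
  only their values at indices from \<open>V\<close> matter.\<close>

definition adjacency_matrix :: "'a hypergraph \<Rightarrow> 'a \<Rightarrow> 'a \<Rightarrow> complex" where
  "adjacency_matrix G i j = (if {i, j} \<in> edges G then 1 else 0)"

definition matrix_eigenvalue :: "'a set \<Rightarrow> ('a \<Rightarrow> 'a \<Rightarrow> complex) \<Rightarrow> complex \<Rightarrow> bool" where
  "matrix_eigenvalue V A \<mu> \<longleftrightarrow>
     (\<exists>u. (\<exists>i\<in>V. u i \<noteq> 0) \<and> (\<forall>i\<in>V. (\<Sum>j\<in>V. A i j * u j) = \<mu> * u i))"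

text \<open>A tensor of order \<open>k\<close> assigns an entry to each index list of length \<open>k\<close>.\<close>

type_synonym 'a tensor = "'a list \<Rightarrow> complex"

definition tensor_apply :: "nat \<Rightarrow> 'a set \<Rightarrow> 'a tensor \<Rightarrow> ('a \<Rightarrow> complex) \<Rightarrow> 'a \<Rightarrow> complex" where
  "tensor_apply k V T y i =
     (\<Sum>js \<in> {js. set js \<subseteq> V \<and> length js = k - 1}. T (i # js) * prod_list (map y js))"

definition tensor_eigenvalue :: "nat \<Rightarrow> 'a set \<Rightarrow> 'a tensor \<Rightarrow> complex \<Rightarrow> bool" where
  "tensor_eigenvalue k V T \<mu> \<longleftrightarrow>
     (\<exists>y. (\<exists>i\<in>V. y i \<noteq> 0) \<and> (\<forall>i\<in>V. tensor_apply k V T y i = \<mu> * y i ^ (k - 1)))"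

definition adjacency_tensor :: "nat \<Rightarrow> 'a hypergraph \<Rightarrow> 'a tensor" where
  "adjacency_tensor k H is = (if set is \<in> edges H then 1 / fact (k - 1) else 0)"

definition degree_tensor :: "nat \<Rightarrow> 'a hypergraph \<Rightarrow> 'a tensor" where
  "degree_tensor k H is =
     (if is = replicate k (hd is) then of_nat (degree H (hd is)) else 0)"

definition laplacian_tensor :: "nat \<Rightarrow> 'a hypergraph \<Rightarrow> 'a tensor" where
  "laplacian_tensor k H is = degree_tensor k H is - adjacency_tensor k H is"

text \<open>\<open>New e j\<close> is the added vertex $i_{e,j}$.\<close>

datatype 'a power_vertex = Old 'a | New "'a set" nat

definition graph_power :: "nat \<Rightarrow> 'a hypergraph \<Rightarrow> 'a power_vertex hypergraph" where
  "graph_power k G =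
     \<lparr>verts = Old ` verts G \<union> {New e j | e j. e \<in> edges G \<and> j \<in> {1..k - 2}},
      edges = {Old ` e \<union> New e ` {1..k - 2} | e. e \<in> edges G}\<rparr>"

lemma uniform_graph_power:
  assumes "simple_graph G" "k \<ge> 3"
  shows "uniform_hypergraph k (graph_power k G)"
proof -
  have V: "finite (verts G)" and E: "\<And>e. e \<in> edges G \<Longrightarrow> e \<subseteq> verts G \<and> card e = 2"
    using assms(1) by (auto simp: uniform_hypergraph_def)
  have "edges G \<subseteq> Pow (verts G)"
    using E by auto
  then have fE: "finite (edges G)"
    using V by (meson finite_Pow_iff finite_subset)
  have "{New e j | e j. e \<in> edges G \<and> j \<in> {1..k - 2}}
      = (\<lambda>(e, j). New e j) ` (edges G \<times> {1..k - 2})"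
    by auto
  then have fin: "finite (verts (graph_power k G))"
    using V fE by (simp add: graph_power_def)
  have card: "card (Old ` e \<union> New e ` {1..k - 2}) = k" if "e \<in> edges G" for e
  proof -
    have "finite e"
      using E[OF that] V finite_subset by blast
    then have "card (Old ` e \<union> New e ` {1..k - 2}) = card (Old ` e) + card (New e ` {1..k - 2})"
      by (intro card_Un_disjoint) auto
    also have "\<dots> = card e + (k - 2)"
      by (simp add: card_image inj_on_def)
    finally show ?thesis
      using E[OF that] assms(2) by simp
  qed
  have "e' \<subseteq> verts (graph_power k G) \<and> card e' = k" if e': "e' \<in> edges (graph_power k G)" for e'
  proof -
    obtain e where e: "e \<in> edges G" "e' = Old ` e \<union> New e ` {1..k - 2}"
      using e' by (auto simp: graph_power_def)
    have "e' \<subseteq> verts (graph_power k G)"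
      using e E[OF e(1)] by (auto simp: graph_power_def)
    then show ?thesis
      using card[OF e(1)] e(2) by simp
  qed
  with fin show ?thesis
    by (auto simp: uniform_hypergraph_def)
qed

text \<open>The possible values of $z^{m/2}$: for odd \<open>m\<close> one value for each choice of square root of \<open>z\<close>.\<close>

definition half_powers :: "complex \<Rightarrow> nat \<Rightarrow> complex set" where
  "half_powers z m = (if even m then {z ^ (m div 2)} else {s ^ m | s. s ^ 2 = z})"

end

theory Submission
  imports Defs "HOL-Combinatorics.Multiset_Permutations"
begin

text \<open>
  Let \<open>u\<close> be an eigenvector of \<open>G\<close> for \<open>\<alpha>\<close>, and choose \<open>s\<close> with \<open>s\<^sup>2 = 1 - x\<close> and \<open>t i\<close> with
  \<open>t i ^ k = u i\<close>. Weighting each old vertex by \<open>(t i)\<^sup>2\<close> and each new vertex of an edge \<open>{a, b}\<close> by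
  \<open>t a * t b / s\<close> gives an eigenvector of the Laplacian tensor for \<open>x\<close>. Using squares \<open>(t i)\<^sup>2\<close>
  avoids the sign ambiguity in \<open>(t a * t b) ^ (k - 2)\<close>; at a vertex \<open>i\<close> of \<open>G\<close> the equation becomes
  the eigenvector equation of \<open>u\<close> multiplied by \<open>t i ^ (k - 2)\<close>.
\<close>

section \<open>Tensors of a uniform hypergraph applied to a vector\<close>

lemma finite_edges_uniform:
  assumes "uniform_hypergraph k H"
  shows "finite (edges H)"
proof -
  have "edges H \<subseteq> Pow (verts H)" "finite (verts H)"
    using assms by (auto simp: uniform_hypergraph_def)
  then show ?thesis
    by (meson finite_Pow_iff finite_subset)
qed

text \<open>The list \<open>i # js\<close> has length k and an edge has k elements, so if the list
  spans an edge, no entry repeats. Hence \<open>js\<close> runs through the other vertices of that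
  edge exactly once each.\<close>

lemma lists_spanning_uniform_edge:
  assumes "uniform_hypergraph k H" "k \<ge> 1"
  shows "{js. set js \<subseteq> verts H \<and> length js = k - 1 \<and> set (i # js) \<in> edges H}
    = (\<Union>e\<in>{e \<in> edges H. i \<in> e}. permutations_of_set (e - {i}))" (is "?L = ?R")
proof (intro equalityI subsetI)
  fix js assume js: "js \<in> ?L"
  then have "card (set (i # js)) = length (i # js)"
    using assms by (auto simp: uniform_hypergraph_def)
  then have "distinct (i # js)"
    by (rule card_distinct)
  then have "js \<in> permutations_of_set (set (i # js) - {i})"
    by (auto simp: permutations_of_set_def)
  then show "js \<in> ?R"
    using js by auto
next
  fix js assume "js \<in> ?R"
  then obtain e where e: "e \<in> edges H" "i \<in> e" and js: "set js = e - {i}" "distinct js"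
    by (auto simp: permutations_of_set_def)
  have "card e = k" "e \<subseteq> verts H"
    using assms e by (auto simp: uniform_hypergraph_def)
  moreover have "length js = card (e - {i})"
    using js distinct_card by metis
  moreover have "set (i # js) = e"
    using js e by auto
  ultimately show "js \<in> ?L"
    using e js assms by (auto simp: card_Diff_singleton)
qed

text \<open>Each edge at \<open>i\<close> contributes the same product once for every ordering of
  its other k - 1 vertices. These (k - 1)! equal terms cancel the entry 1 / (k - 1)! of the
  tensor.\<close>

lemma tensor_apply_adjacency:
  assumes H: "uniform_hypergraph k H" and k: "k \<ge> 1"
  shows "tensor_apply k (verts H) (adjacency_tensor k H) y i
    = (\<Sum>e\<in>{e \<in> edges H. i \<in> e}. prod y (e - {i}))"
proof -
  let ?S = "{js. set js \<subseteq> verts H \<and> length js = k - 1}"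
  let ?f = "\<lambda>js. 1 / fact (k - 1) * prod_list (map y js) :: complex"
  have fine: "finite e" if "e \<in> edges H" for e
    using H that by (auto simp: uniform_hypergraph_def intro: finite_subset)
  have finS: "finite ?S"
    using H by (intro finite_lists_length_eq) (auto simp: uniform_hypergraph_def)
  have "tensor_apply k (verts H) (adjacency_tensor k H) y i
      = (\<Sum>js\<in>?S. if set (i # js) \<in> edges H then ?f js else 0)"
    unfolding tensor_apply_def adjacency_tensor_def by (intro sum.cong) auto
  also have "\<dots> = sum ?f {js \<in> ?S. set (i # js) \<in> edges H}"
    using finS by (rule sum.inter_filter [symmetric])
  also have "{js \<in> ?S. set (i # js) \<in> edges H}
      = {js. set js \<subseteq> verts H \<and> length js = k - 1 \<and> set (i # js) \<in> edges H}"
    by auto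
  also have "\<dots> = (\<Union>e\<in>{e \<in> edges H. i \<in> e}. permutations_of_set (e - {i}))"
    by (rule lists_spanning_uniform_edge [OF H k])
  also have "sum ?f \<dots> = (\<Sum>e\<in>{e \<in> edges H. i \<in> e}. sum ?f (permutations_of_set (e - {i})))"
  proof (rule sum.UNION_disjoint)
    \<comment> \<open>A common list would give \<open>e - {i} = e' - {i}\<close>, and since both
      edges contain \<open>i\<close>, they would coincide.\<close>
    show "\<forall>e\<in>{e \<in> edges H. i \<in> e}. \<forall>e'\<in>{e \<in> edges H. i \<in> e}. e \<noteq> e' \<longrightarrow>
        permutations_of_set (e - {i}) \<inter> permutations_of_set (e' - {i}) = {}"
      by (auto simp: permutations_of_set_def)
  qed (use finite_edges_uniform [OF H] in auto)
  also have "\<dots> = (\<Sum>e\<in>{e \<in> edges H. i \<in> e}. prod y (e - {i}))"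
  proof (rule sum.cong [OF refl])
    fix e assume e: "e \<in> {e \<in> edges H. i \<in> e}"
    then have "card (e - {i}) = k - 1"
      using H by (auto simp: uniform_hypergraph_def card_Diff_singleton)
    then have card: "card (permutations_of_set (e - {i})) = fact (k - 1)"
      using fine e by simp
    have "sum ?f (permutations_of_set (e - {i}))
        = (\<Sum>js\<in>permutations_of_set (e - {i}). 1 / fact (k - 1) * prod y (e - {i}))"
      by (intro sum.cong refl)
        (auto simp: permutations_of_set_def prod.distinct_set_conv_list [symmetric])
    also have "\<dots> = prod y (e - {i})"
      by (simp add: card)
    finally show "sum ?f (permutations_of_set (e - {i})) = prod y (e - {i})" .
  qed
  finally show ?thesis .
qed

lemma tensor_apply_degree:
  assumes "finite (verts H)" "i \<in> verts H" "k \<ge> 1"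
  shows "tensor_apply k (verts H) (degree_tensor k H) y i = of_nat (degree H i) * y i ^ (k - 1)"
proof -
  let ?S = "{js. set js \<subseteq> verts H \<and> length js = k - 1}"
  \<comment> \<open>Only the constant list meets the diagonal, so the sum collapses to one
    term.\<close>
  have rep: "i # js = replicate k i \<longleftrightarrow> js = replicate (k - 1) i" for js
    using assms(3) by (cases k) auto
  have "tensor_apply k (verts H) (degree_tensor k H) y i
      = (\<Sum>js\<in>?S. if js = replicate (k - 1) i then of_nat (degree H i) * y i ^ (k - 1) else 0)"
    unfolding tensor_apply_def degree_tensor_def list.sel rep
    by (intro sum.cong) auto
  also have "\<dots> = of_nat (degree H i) * y i ^ (k - 1)"
    using assms finite_lists_length_eq [OF assms(1)] by (subst sum.delta) auto
  finally show ?thesis .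
qed

lemma tensor_apply_laplacian:
  assumes "uniform_hypergraph k H" "i \<in> verts H" "k \<ge> 1"
  shows "tensor_apply k (verts H) (laplacian_tensor k H) y i
    = of_nat (degree H i) * y i ^ (k - 1) - (\<Sum>e\<in>{e \<in> edges H. i \<in> e}. prod y (e - {i}))"
proof -
  have "finite (verts H)"
    using assms(1) by (simp add: uniform_hypergraph_def)
  then show ?thesis
    using tensor_apply_adjacency [OF assms(1,3), of y i] tensor_apply_degree [of H i k y] assms
    by (simp add: tensor_apply_def laplacian_tensor_def left_diff_distrib sum_subtractf)
qed

section \<open>Incidence in the power hypergraph and in the graph\<close>

definition power_edge :: "nat \<Rightarrow> 'a set \<Rightarrow> 'a power_vertex set" where
  "power_edge k e = Old ` e \<union> New e ` {1..k - 2}"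

lemma edges_graph_power: "edges (graph_power k G) = power_edge k ` edges G"
  by (auto simp: graph_power_def power_edge_def)

lemma inj_power_edge: "inj (power_edge k)"
proof (rule injI)
  fix e f :: "'a set"
  assume "power_edge k e = power_edge k f"
  \<comment> \<open>The old vertices of a power edge are exactly the vertices of the edge it came
    from.\<close>
  then have "Old -` power_edge k e = Old -` power_edge k f"
    by simp
  then show "e = f"
    by (auto simp: power_edge_def)
qed

lemma edges_at_Old:
  "{e' \<in> edges (graph_power k G). Old i \<in> e'} = power_edge k ` {e \<in> edges G. i \<in> e}"
  by (auto simp: edges_graph_power power_edge_def)

lemma edges_at_New:
  assumes "e \<in> edges G" "j \<in> {1..k - 2}"
  shows "{e' \<in> edges (graph_power k G). New e j \<in> e'} = {power_edge k e}"
  using assms by (auto simp: edges_graph_power power_edge_def)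

text \<open>Links the two languages: tensor sums and degrees range over edges, while
  \<open>regular\<close> and the adjacency matrix speak of neighbours.\<close>

lemma edges_at_vertex_eq_neighbours:
  assumes "simple_graph G"
  shows "{e \<in> edges G. i \<in> e} = (\<lambda>j. {i, j}) ` neighbours G i"
proof (intro equalityI subsetI)
  fix e assume e: "e \<in> {e \<in> edges G. i \<in> e}"
  then have "card e = 2" "e \<subseteq> verts G"
    using assms by (auto simp: uniform_hypergraph_def)
  then obtain a b where "e = {a, b}"
    by (auto simp: card_2_iff)
  then obtain j where "e = {i, j}"
    using e by auto
  then show "e \<in> (\<lambda>j. {i, j}) ` neighbours G i"
    using e \<open>e \<subseteq> verts G\<close> by (auto simp: neighbours_def)
qed (auto simp: neighbours_def)

lemma inj_on_doubleton: "inj_on (\<lambda>j. {i, j}) A"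
  by (auto simp: inj_on_def doubleton_eq_iff)

lemma neighbour_neq:
  assumes "simple_graph G" "j \<in> neighbours G i"
  shows "j \<noteq> i"
proof
  assume "j = i"
  then have "card {i} = 2"
    using assms by (auto simp: neighbours_def uniform_hypergraph_def)
  then show False
    by simp
qed

lemma sum_adjacency_matrix:
  assumes "finite (verts G)"
  shows "(\<Sum>j\<in>verts G. adjacency_matrix G i j * u j) = sum u (neighbours G i)"
proof -
  have "(\<Sum>j\<in>verts G. adjacency_matrix G i j * u j)
      = (\<Sum>j\<in>verts G. if {i, j} \<in> edges G then u j else 0)"
    by (intro sum.cong) (auto simp: adjacency_matrix_def)
  then show ?thesis
    using assms by (simp add: neighbours_def sum.inter_filter)
qed

section \<open>The Laplacian tensor at old and new vertices\<close>

text \<open>For a vector that is constant on the new vertices of each edge, the edge to a neighbour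
  \<open>j\<close> leaves one factor from \<open>j\<close> and k - 2 equal factors
  \<open>z {i, j}\<close>.\<close>

lemma tensor_apply_laplacian_Old:
  assumes G: "simple_graph G" and k: "k \<ge> 3" and i: "i \<in> verts G"
    and y: "\<And>e j. y (New e j) = z e"
  shows "tensor_apply k (verts (graph_power k G)) (laplacian_tensor k (graph_power k G)) y (Old i)
    = of_nat (card (neighbours G i)) * y (Old i) ^ (k - 1)
      - (\<Sum>j\<in>neighbours G i. y (Old j) * z {i, j} ^ (k - 2))"
proof -
  let ?H = "graph_power k G"
  have H: "uniform_hypergraph k ?H"
    using G k by (rule uniform_graph_power)
  have at_i: "{e' \<in> edges ?H. Old i \<in> e'} = (\<lambda>j. power_edge k {i, j}) ` neighbours G i"
    by (simp add: edges_at_Old edges_at_vertex_eq_neighbours [OF G] image_image)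
  have inj: "inj_on (\<lambda>j. power_edge k {i, j}) (neighbours G i)"
    using comp_inj_on [OF inj_on_doubleton inj_on_subset [OF inj_power_edge subset_UNIV]]
    by (simp add: o_def)
  have "prod y (power_edge k {i, j} - {Old i}) = y (Old j) * z {i, j} ^ (k - 2)"
    if "j \<in> neighbours G i" for j
  proof -
    have "power_edge k {i, j} - {Old i} = insert (Old j) (New {i, j} ` {1..k - 2})"
      using neighbour_neq [OF G that] by (auto simp: power_edge_def)
    then have "prod y (power_edge k {i, j} - {Old i}) = y (Old j) * prod y (New {i, j} ` {1..k - 2})"
      by (simp add: image_iff)
    also have "prod y (New {i, j} ` {1..k - 2}) = z {i, j} ^ (k - 2)"
      by (subst prod.reindex) (auto simp: inj_on_def y)
    finally show ?thesis .
  qed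
  then have "(\<Sum>e'\<in>{e' \<in> edges ?H. Old i \<in> e'}. prod y (e' - {Old i}))
      = (\<Sum>j\<in>neighbours G i. y (Old j) * z {i, j} ^ (k - 2))"
    by (simp add: at_i sum.reindex [OF inj])
  moreover have "degree ?H (Old i) = card (neighbours G i)"
    by (simp add: degree_def at_i card_image [OF inj])
  moreover have "Old i \<in> verts ?H"
    using i by (simp add: graph_power_def)
  ultimately show ?thesis
    using tensor_apply_laplacian [OF H] k by simp
qed

text \<open>A new vertex lies in a single edge, so its degree is 1. Removing it leaves both old ends
  of the edge and k - 3 equal factors \<open>z e\<close>.\<close>

lemma tensor_apply_laplacian_New:
  assumes G: "simple_graph G" and k: "k \<ge> 3" and e: "e \<in> edges G" and j: "j \<in> {1..k - 2}"
    and y: "\<And>e j. y (New e j) = z e"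
  shows "tensor_apply k (verts (graph_power k G)) (laplacian_tensor k (graph_power k G)) y (New e j)
    = z e ^ (k - 1) - (\<Prod>a\<in>e. y (Old a)) * z e ^ (k - 3)"
proof -
  let ?H = "graph_power k G"
  have H: "uniform_hypergraph k ?H"
    using G k by (rule uniform_graph_power)
  have "finite e"
    using G e by (auto simp: uniform_hypergraph_def intro: finite_subset)
  have "power_edge k e - {New e j} = Old ` e \<union> New e ` ({1..k - 2} - {j})"
    by (auto simp: power_edge_def)
  then have "prod y (power_edge k e - {New e j})
      = prod y (Old ` e) * prod y (New e ` ({1..k - 2} - {j}))"
    using \<open>finite e\<close> by (auto intro: prod.union_disjoint)
  also have "prod y (Old ` e) = (\<Prod>a\<in>e. y (Old a))"
    by (subst prod.reindex) (auto simp: inj_on_def)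
  also have "prod y (New e ` ({1..k - 2} - {j})) = z e ^ card ({1..k - 2} - {j})"
    by (subst prod.reindex) (auto simp: inj_on_def y)
  also have "card ({1..k - 2} - {j}) = k - 3"
    using j by (simp add: card_Diff_singleton)
  finally have "prod y (power_edge k e - {New e j}) = (\<Prod>a\<in>e. y (Old a)) * z e ^ (k - 3)" .
  moreover have "degree ?H (New e j) = 1"
    by (simp add: degree_def edges_at_New [OF e j])
  moreover have "New e j \<in> verts ?H"
    using e j by (auto simp: graph_power_def)
  ultimately show ?thesis
    using tensor_apply_laplacian [OF H] k by (simp add: edges_at_New [OF e j] y)
qed

section \<open>Complex roots\<close>

text \<open>Removes the case split on parity: for even \<open>m\<close> every square root of
  \<open>z\<close> has the same \<open>m\<close>-th power, so \<open>csqrt z\<close> serves as well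
  as any other.\<close>

lemma half_powers_E:
  assumes "p \<in> half_powers z m"
  obtains s where "s\<^sup>2 = z" "p = s ^ m"
proof (cases "even m")
  case True
  have "(csqrt z)\<^sup>2 = z"
    by simp
  moreover have "p = csqrt z ^ m"
    using assms True by (auto simp: half_powers_def power_mult elim!: evenE)
  ultimately show ?thesis
    by (rule that)
next
  case False
  then show ?thesis
    using assms that by (auto simp: half_powers_def)
qed

lemma complex_nth_root_exists:
  fixes w :: complex
  assumes "n > 0"
  shows "\<exists>t. t ^ n = w"
proof (cases "w = 0")
  case True
  then show ?thesis
    using assms by (intro exI [of _ 0]) simp
next
  case False
  then have "card {t. t ^ n = w} = n"
    using assms by (intro card_nth_roots)
  then have "{t. t ^ n = w} \<noteq> {}"
    using assms by (intro notI) simp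
  then show ?thesis
    by blast
qed

section \<open>The eigenvector of the Laplacian tensor\<close>

theorem theorem4p10:
  fixes G :: "'a hypergraph" and k d :: nat and \<alpha> x :: complex
  assumes "k \<ge> 3"
    and "simple_graph G"
    and "regular d G"
    and "matrix_eigenvalue (verts G) (adjacency_matrix G) \<alpha>"
    and "\<alpha> \<noteq> 0"
    and "\<exists>p \<in> half_powers (1 - x) (k - 2). (of_nat d - x) * p - \<alpha> = 0"
  shows "tensor_eigenvalue k (verts (graph_power k G)) (laplacian_tensor k (graph_power k G)) x"
proof -
  let ?H = "graph_power k G"
  note k = assms(1) and G = assms(2)
  have finV: "finite (verts G)"
    using G by (simp add: uniform_hypergraph_def)
  obtain s where s: "s\<^sup>2 = 1 - x" and \<alpha>: "(of_nat d - x) * s ^ (k - 2) = \<alpha>"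
    using assms(6) by (auto elim!: half_powers_E)
  \<comment> \<open>As k - 2 > 0, s = 0 would give \<alpha> = 0. This makes the division by
    \<open>s\<close> below legitimate.\<close>
  have s0: "s \<noteq> 0"
    using \<alpha> assms(1,5) by auto
  obtain u where u: "\<exists>i\<in>verts G. u i \<noteq> 0"
    and eig: "\<And>i. i \<in> verts G \<Longrightarrow> sum u (neighbours G i) = \<alpha> * u i"
    using assms(4) by (auto simp: matrix_eigenvalue_def sum_adjacency_matrix [OF finV])
  have "\<forall>i. \<exists>c. c ^ k = u i"
    using k by (intro allI complex_nth_root_exists) simp
  then obtain t where t: "\<And>i. t i ^ k = u i"
    by metis
  \<comment> \<open>The equation at a new vertex asks for \<open>z e ^ (k - 1)\<close> times 1 - x
    to equal the product of the two old weights times \<open>z e ^ (k - 3)\<close>. It holds once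
    that product is \<open>s\<^sup>2 * (z e)\<^sup>2\<close>, which dictates this choice.\<close>
  define z where "z e = prod t e / s" for e
  define y where "y v = (case v of Old i \<Rightarrow> (t i)\<^sup>2 | New e j \<Rightarrow> z e)" for v
  have y_Old: "y (Old i) = (t i)\<^sup>2" and y_New: "y (New e j) = z e" for i e j
    by (simp_all add: y_def)
  have "tensor_apply k (verts ?H) (laplacian_tensor k ?H) y (Old i) = x * y (Old i) ^ (k - 1)"
    if i: "i \<in> verts G" for i
  proof -
    have "y (Old j) * z {i, j} ^ (k - 2) = t i ^ (k - 2) / s ^ (k - 2) * u j"
      if "j \<in> neighbours G i" for j
    proof -
      \<comment> \<open>The square comes from the weight of \<open>Old j\<close>; the remaining k -
        2 factors come from the new vertices of the edge.\<close>
      have "u j = (t j)\<^sup>2 * t j ^ (k - 2)"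
        using k by (simp only: t [symmetric] power_add [symmetric])
          (rule arg_cong [where f = "power (t j)"], simp)
      then show ?thesis
        using neighbour_neq [OF G that]
        by (simp add: y_Old z_def power_divide power_mult_distrib mult_ac)
    qed
    then have "(\<Sum>j\<in>neighbours G i. y (Old j) * z {i, j} ^ (k - 2))
        = (\<Sum>j\<in>neighbours G i. t i ^ (k - 2) / s ^ (k - 2) * u j)"
      by (rule sum.cong [OF refl])
    also have "\<dots> = t i ^ (k - 2) / s ^ (k - 2) * (\<alpha> * u i)"
      by (simp only: eig [OF i] sum_distrib_left [symmetric])
    \<comment> \<open>The root equation replaces \<alpha> by (d - x) times
      \<open>s ^ (k - 2)\<close>, which cancels the denominator.\<close>
    also have "\<dots> = (of_nat d - x) * (t i ^ (k - 2) * t i ^ k)"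
      using s0 by (simp add: \<alpha> [symmetric] t)
    also have "t i ^ (k - 2) * t i ^ k = t i ^ (2 * (k - 1))"
      using k by (simp only: power_add [symmetric]) (rule arg_cong [where f = "power (t i)"], simp)
    also have "\<dots> = y (Old i) ^ (k - 1)"
      by (simp add: y_Old power_mult)
    \<comment> \<open>By regularity the degree term has coefficient d, and d - (d - x) = x.\<close>
    finally show ?thesis
      using tensor_apply_laplacian_Old [where y = y and z = z, OF G k i y_New] assms(3) i
      by (simp add: regular_def left_diff_distrib)
  qed
  moreover have "tensor_apply k (verts ?H) (laplacian_tensor k ?H) y (New e j) = x * y (New e j) ^ (k - 1)"
    if e: "e \<in> edges G" and j: "j \<in> {1..k - 2}" for e j
  proof -
    \<comment> \<open>The product of the squares \<open>(t a)\<^sup>2\<close> is the square of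
      \<open>prod t e\<close>, that is, of \<open>s * z e\<close>.\<close>
    have "(\<Prod>a\<in>e. y (Old a)) = s\<^sup>2 * (z e)\<^sup>2"
      using s0 by (simp add: y_Old z_def power_divide prod_power_distrib)
    then have "(\<Prod>a\<in>e. y (Old a)) * z e ^ (k - 3) = (1 - x) * ((z e)\<^sup>2 * z e ^ (k - 3))"
      by (simp add: s)
    \<comment> \<open>Here k \<ge> 3 matters: the subtraction in k - 3 is not truncated.\<close>
    also have "(z e)\<^sup>2 * z e ^ (k - 3) = z e ^ (k - 1)"
      using k by (simp only: power_add [symmetric]) (rule arg_cong [where f = "power (z e)"], simp)
    finally show ?thesis
      using tensor_apply_laplacian_New [where y = y and z = z, OF G k e j y_New] by (simp add: y_New left_diff_distrib)
  qed
  moreover have "(\<exists>i\<in>verts G. v = Old i) \<or> (\<exists>e\<in>edges G. \<exists>j\<in>{1..k - 2}. v = New e j)"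
    if "v \<in> verts ?H" for v
    using that by (auto simp: graph_power_def)
  ultimately have "\<forall>v\<in>verts ?H. tensor_apply k (verts ?H) (laplacian_tensor k ?H) y v = x * y v ^ (k - 1)"
    by metis
  moreover have "\<exists>v\<in>verts ?H. y v \<noteq> 0"
  proof -
    obtain i where "i \<in> verts G" "u i \<noteq> 0"
      using u by blast
    \<comment> \<open>If \<open>t i\<close> were 0, then so would be its k-th power
      \<open>u i\<close>.\<close>
    moreover from this have "y (Old i) \<noteq> 0"
      using t [of i] k by (auto simp: y_Old zero_power)
    ultimately show ?thesis
      by (auto simp: graph_power_def)
  qed
  ultimately show ?thesis
    by (auto simp: tensor_eigenvalue_def)
qed

end
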